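(* Let $1\le b\le c$ be real numbers and $d\ge1$ an integer, and suppose that condition $\mathfrak S_{bcd}$ holds. Then the upper bound $K^{\mathscr S}_{\ell,b\ell,c\ell,d}$ on $K_{\ell,b\ell,c\ell,d}$ has the asymptotics $$K^{\mathscr S}_{\ell,b\ell,c\ell,d}=\frac{1+O(1/\ell)}{[4(b+c)\pi\ell]^{d/4}}\qquad(\ell\to+\infty).$$
   Context: Here $\ell$ is a real variable with $\ell>\frac{d}{2(b+c-1)}$. For real $0\le\ell\le m\le n$ with $m+n-\ell>d/2$, $$K^{\mathscr S}_{\ell mnd}:=\sqrt{\sup_{u\in[0,+\infty)}\mathscr S_{\ell mnd}(u)},\qquad \mathscr S_{\ell mnd}(u):=\frac{\Gamma(m+n-d/2)}{(4\pi)^{d/2}\Gamma(m+n)}(1+4u)^\ell\,{}_3F_2\Big(m+n-\tfrac d2,m,n;\tfrac{m+n}2,\tfrac{m+n+1}2;-u\Big),$$ ${}_3F_2$ being the generalized hypergeometric function, real-analytically continued from $(-1,1)$ to $(-\infty,1)$ in its argument. (It is an upper bound for the sharp constant $K_{\ell mnd}$ in $\|fg\|_\ell\le K\|f\|_m\|g\|_n$, where $\|\cdot\|_\ell$ is the norm of the Bessel potential space $H^\ell(\mathbb R^d,\mathbb C)$.) Condition $\mathfrak S_{bcd}$ is the statement that $$\sup_{u\in[0,+\infty)}\Sigma_{bcd\ell}(u)=1+O(1/\ell)\qquad\text{for }\ell\to+\infty,$$ where $$\Sigma_{bcd\ell}(u):=(1+4u)^\ell\,{}_3F_2\Big((b+c)\ell-\tfrac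 d2,\,b\ell,\,c\ell;\ \tfrac{(b+c)\ell}2,\,\tfrac{(b+c)\ell+1}2;\ -u\Big).$$ *)

theory Defs
  imports "HOL-Analysis.Analysis" "HOL-Library.Landau_Symbols"
begin

definition real_analytic_on :: "(real \<Rightarrow> real) \<Rightarrow> real set \<Rightarrow> bool" where
  "real_analytic_on f S \<longleftrightarrow> (\<forall>x\<in>S. \<exists>F. (\<lambda>h. f (x + h)) has_fps_expansion F)"

text \<open>The power series of the generalized hypergeometric function, which converges on
  the interval from -1 to 1, is continued real-analytically to all arguments below 1.
  By the identity theorem the value does not depend on the choice of the continuation.\<close>

definition hyp3F2 :: "real \<Rightarrow> real \<Rightarrow> real \<Rightarrow> real \<Rightarrow> real \<Rightarrow> real \<Rightarrow> real" where
  "hyp3F2 a\<^sub>1 a\<^sub>2 a\<^sub>3 b\<^sub>1 b\<^sub>2 x =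
     (THE y. \<exists>f. real_analytic_on f {..<1} \<and>
        (\<forall>t\<in>{-1<..<1}. f t = eval_fps (fps_hypergeo [a\<^sub>1, a\<^sub>2, a\<^sub>3] [b\<^sub>1, b\<^sub>2] 1) t) \<and>
        y = f x)"

definition S_fun :: "real \<Rightarrow> real \<Rightarrow> real \<Rightarrow> nat \<Rightarrow> real \<Rightarrow> real" where
  "S_fun l m n d u =
     Gamma (m + n - real d / 2) / ((4 * pi) powr (real d / 2) * Gamma (m + n)) *
     (1 + 4 * u) powr l *
     hyp3F2 (m + n - real d / 2) m n ((m + n) / 2) ((m + n + 1) / 2) (- u)"

text \<open>Suprema are taken in the extended reals, since a supremum in the type of reals
  has no meaning for an unbounded function; accordingly the square root is extended
  by the value infinity at infinity.\<close>

definition ereal_sqrt :: "ereal \<Rightarrow> ereal" where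
  "ereal_sqrt x = (if x = \<infinity> then \<infinity> else ereal (sqrt (real_of_ereal x)))"

definition K_S :: "real \<Rightarrow> real \<Rightarrow> real \<Rightarrow> nat \<Rightarrow> ereal" where
  "K_S l m n d = ereal_sqrt (SUP u\<in>{0..}. ereal (S_fun l m n d u))"

definition Sigma_fun :: "real \<Rightarrow> real \<Rightarrow> nat \<Rightarrow> real \<Rightarrow> real \<Rightarrow> real" where
  "Sigma_fun b c d l u =
     (1 + 4 * u) powr l *
     hyp3F2 ((b + c) * l - real d / 2) (b * l) (c * l)
       ((b + c) * l / 2) (((b + c) * l + 1) / 2) (- u)"

definition condition_S :: "real \<Rightarrow> real \<Rightarrow> nat \<Rightarrow> bool" where
  "condition_S b c d \<longleftrightarrow>
     (\<exists>r :: real \<Rightarrow> real. r \<in> O[at_top](\<lambda>l. 1 / l) \<and>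
        (\<forall>\<^sub>F l in at_top. (SUP u\<in>{0..}. ereal (Sigma_fun b c d l u)) = ereal (1 + r l)))"

end

theory Submission
  imports Defs "HOL-Real_Asymp.Real_Asymp"
begin

text \<open>
  With \<open>m = b * l\<close> and \<open>n = c * l\<close>, the function whose supremum defines the bound is
  \<open>Sigma_fun b c d l\<close> times a positive factor that does not depend on \<open>u\<close>. This factor comes
  out of the supremum, and the hypothesis on \<open>b\<close>, \<open>c\<close>, \<open>d\<close> evaluates what remains as
  \<open>1 + O(1 / l)\<close>.

  What is left is the size of the factor, hence of the quotient
  \<open>Gamma (s - a) / Gamma s\<close> for \<open>s = (b + c) * l\<close> and \<open>a = d / 2\<close>. Log-convexity of the Gamma
  function squeezes it between \<open>s powr - a\<close> and \<open>(s - a - 1) powr - a\<close>, and both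
  of these are \<open>s powr - a * (1 + O(1 / s))\<close>. The
  two relative errors multiply to one of the same order, which also survives the square root;
  the powers of \<open>4 * pi\<close> and of \<open>s\<close> combine to the stated denominator.
\<close>

text \<open>
  The average slope of the convex function \<open>ln \<circ> Gamma\<close> on \<open>[s - a, s]\<close> lies between its
  average slopes on the adjacent unit intervals \<open>[s - a - 1, s - a]\<close> and \<open>[s, s + 1]\<close>, which
  by the functional equation are \<open>ln (s - a - 1)\<close> and \<open>ln s\<close>.
\<close>

lemma Gamma_quotient_bounds:
  fixes s a :: real
  assumes a: "0 < a" and s: "a + 1 < s"
  shows "s powr - a \<le> Gamma (s - a) / Gamma s"
    and "Gamma (s - a) / Gamma s \<le> (s - a - 1) powr - a"
proof -
  let ?L = "ln \<circ> Gamma :: real \<Rightarrow> real"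
  have step: "?L (x + 1) - ?L x = ln x" if "0 < x" for x
  proof -
    have "Gamma (x + 1) = x * Gamma x"
      using that by (intro Gamma_plus1) (auto elim!: nonpos_Ints_cases')
    with that show ?thesis
      by (simp add: ln_mult Gamma_real_pos less_imp_neq[symmetric])
  qed
  note slope = convex_on_slope_le[OF log_convex_Gamma_real]
  have upper: "(?L s - ?L (s - a)) / a \<le> ln s"
  proof -
    have "(?L (s - a) - ?L s) / (s - a - s) \<le> (?L (s - a) - ?L (s + 1)) / (s - a - (s + 1))"
      by (rule slope(1)) (use a s in auto)
    also have "\<dots> \<le> (?L s - ?L (s + 1)) / (s - (s + 1))"
      by (rule slope(2)) (use a s in auto)
    finally show ?thesis
      using step[of s] a s by (simp add: field_simps)
  qed
  have lower: "ln (s - a - 1) \<le> (?L s - ?L (s - a)) / a"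
  proof -
    have "(?L (s - a - 1) - ?L (s - a)) / (s - a - 1 - (s - a))
            \<le> (?L (s - a - 1) - ?L s) / (s - a - 1 - s)"
      by (rule slope(1)) (use a s in auto)
    also have "\<dots> \<le> (?L (s - a) - ?L s) / (s - a - s)"
      by (rule slope(2)) (use a s in auto)
    finally show ?thesis
      using step[of "s - a - 1"] a s by (simp add: field_simps)
  qed
  have pos: "Gamma s > 0" "Gamma (s - a) > 0"
    using a s by auto
  have quotient: "Gamma (s - a) / Gamma s = exp (?L (s - a) - ?L s)"
    using pos by (simp add: exp_diff)
  show "s powr - a \<le> Gamma (s - a) / Gamma s"
    unfolding quotient using upper a s by (simp add: powr_def field_simps)
  show "Gamma (s - a) / Gamma s \<le> (s - a - 1) powr - a"
    unfolding quotient using lower a s by (simp add: powr_def field_simps)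
qed

lemma Gamma_quotient_asymptotics:
  fixes a :: real
  assumes a: "0 < a"
  shows "(\<lambda>s. Gamma (s - a) / Gamma s * s powr a - 1) \<in> O[at_top](\<lambda>s. 1 / s)"
proof -
  have "(\<lambda>s. Gamma (s - a) / Gamma s * s powr a - 1)
          \<in> O[at_top](\<lambda>s. (s - a - 1) powr - a * s powr a - 1)"
  proof (rule landau_o.big_mono)
    show "\<forall>\<^sub>F s in at_top. norm (Gamma (s - a) / Gamma s * s powr a - 1)
            \<le> norm ((s - a - 1) powr - a * s powr a - 1)"
      using eventually_gt_at_top[of "a + 1"]
    proof eventually_elim
      case (elim s)
      have "s powr - a * s powr a \<le> Gamma (s - a) / Gamma s * s powr a"
        by (intro mult_right_mono Gamma_quotient_bounds(1) a elim) simp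
      moreover have "s powr - a * s powr a = 1"
        using a elim by (simp flip: powr_add)
      moreover have "Gamma (s - a) / Gamma s * s powr a \<le> (s - a - 1) powr - a * s powr a"
        by (intro mult_right_mono Gamma_quotient_bounds(2) a elim) simp
      ultimately show ?case
        by simp
    qed
  qed
  also have "(\<lambda>s. (s - a - 1) powr - a * s powr a - 1) \<in> O[at_top](\<lambda>s. 1 / s)"
    using a by real_asymp
  finally show ?thesis .
qed

text \<open>
  For \<open>- 1 \<le> x\<close> the left-hand side times \<open>sqrt (1 + x) + 1 \<ge> 1\<close> is \<open>\<bar>x\<bar>\<close>. For \<open>x < - 1\<close>, where
  \<open>sqrt (1 + x) = - sqrt (- 1 - x)\<close>, the left-hand side can exceed \<open>\<bar>x\<bar>\<close>, so the factor 2
  makes the estimate uniform in \<open>x\<close>.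
\<close>

lemma abs_sqrt_one_plus_minus_one_le: "\<bar>sqrt (1 + x) - 1\<bar> \<le> 2 * \<bar>x\<bar>"
proof (cases "- 1 \<le> x")
  case True
  have "\<bar>sqrt (1 + x) - 1\<bar> * 1 \<le> \<bar>sqrt (1 + x) - 1\<bar> * (sqrt (1 + x) + 1)"
    using True by (intro mult_left_mono) auto
  also have "\<dots> = \<bar>(sqrt (1 + x) - 1) * (sqrt (1 + x) + 1)\<bar>"
    using True by (simp add: abs_mult)
  also have "(sqrt (1 + x) - 1) * (sqrt (1 + x) + 1) = x"
    using True by (simp add: algebra_simps)
  finally show ?thesis by simp
next
  case False
  have "sqrt (- (1 + x)) \<le> 1 + - (1 + x)"
    using False mult_nonpos_nonpos[of x "1 + x"]
    by (intro real_le_lsqrt) (auto simp: power2_eq_square algebra_simps)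
  moreover have "sqrt (1 + x) = - sqrt (- (1 + x))"
    by (simp flip: real_sqrt_minus)
  moreover have "0 \<le> sqrt (- (1 + x))"
    using False by simp
  ultimately show ?thesis
    using False by linarith
qed

lemma bigo_sqrt_one_plus_product:
  fixes p q g :: "real \<Rightarrow> real"
  assumes p: "p \<in> O[F](g)" and q: "q \<in> O[F](g)" and g: "g \<in> O[F](\<lambda>_. 1)"
  shows "(\<lambda>x. sqrt ((1 + p x) * (1 + q x)) - 1) \<in> O[F](g)"
proof -
  have "(\<lambda>x. sqrt ((1 + p x) * (1 + q x)) - 1) \<in> O[F](\<lambda>x. p x + q x + p x * q x)"
  proof (rule landau_o.bigI[of 2])
    show "\<forall>\<^sub>F x in F. norm (sqrt ((1 + p x) * (1 + q x)) - 1)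
            \<le> 2 * norm (p x + q x + p x * q x)"
      using abs_sqrt_one_plus_minus_one_le[of "p x + q x + p x * q x" for x]
      by (intro always_eventually) (simp add: algebra_simps)
  qed simp
  also have "(\<lambda>x. p x + q x + p x * q x) \<in> O[F](g)"
  proof (intro sum_in_bigo p q)
    have "(\<lambda>x. p x * q x) \<in> O[F](\<lambda>x. g x * 1)"
      by (intro landau_o.big.mult p landau_o.big_trans[OF q g])
    then show "(\<lambda>x. p x * q x) \<in> O[F](g)" by simp
  qed
  finally show ?thesis .
qed

lemma S_fun_eq_Sigma_fun:
  "S_fun l (b * l) (c * l) d u =
     Gamma ((b + c) * l - real d / 2) / ((4 * pi) powr (real d / 2) * Gamma ((b + c) * l)) *
     Sigma_fun b c d l u"
  by (simp add: S_fun_def Sigma_fun_def distrib_right)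

theorem proposition4p6:
  fixes b c :: real and d :: nat
  assumes "1 \<le> b" and "b \<le> c" and "d \<ge> 1"
    and "condition_S b c d"
  shows "\<exists>r :: real \<Rightarrow> real. r \<in> O[at_top](\<lambda>l. 1 / l) \<and>
           (\<forall>\<^sub>F l in at_top.
              K_S l (b * l) (c * l) d =
                ereal ((1 + r l) / (4 * (b + c) * pi * l) powr (real d / 4)))"
proof -
  define a where "a = real d / 2"
  have a: "0 < a" using assms by (simp add: a_def)
  have bc: "0 < b + c" using assms by simp
  obtain q where q: "q \<in> O[at_top](\<lambda>l. 1 / l)"
    and sup: "\<forall>\<^sub>F l in at_top. (SUP u\<in>{0..}. ereal (Sigma_fun b c d l u)) = ereal (1 + q l)"
    using assms(4) unfolding condition_S_def by blast
  define p where "p l = Gamma ((b + c) * l - a) / Gamma ((b + c) * l) * ((b + c) * l) powr a - 1"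
    for l
  have p: "p \<in> O[at_top](\<lambda>l. 1 / l)"
  proof -
    have "filterlim (\<lambda>l. (b + c) * l) at_top at_top"
      using bc by real_asymp
    then have "p \<in> O[at_top](\<lambda>l. 1 / ((b + c) * l))"
      unfolding p_def by (rule landau_o.big.compose[OF Gamma_quotient_asymptotics[OF a]])
    also have "(\<lambda>l. 1 / ((b + c) * l)) \<in> O[at_top](\<lambda>l. 1 / l)"
      using bc by real_asymp
    finally show ?thesis .
  qed
  define r where "r l = sqrt ((1 + p l) * (1 + q l)) - 1" for l
  have "(\<lambda>l :: real. 1 / l) \<in> O[at_top](\<lambda>_. 1)"
    by real_asymp
  then have r: "r \<in> O[at_top](\<lambda>l. 1 / l)"
    unfolding r_def by (rule bigo_sqrt_one_plus_product[OF p q])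
  have "\<forall>\<^sub>F l in at_top.
          K_S l (b * l) (c * l) d = ereal ((1 + r l) / (4 * (b + c) * pi * l) powr (real d / 4))"
    using sup eventually_gt_at_top[of "(a + 1) / (b + c)"]
  proof eventually_elim
    case (elim l)
    define s where "s = (b + c) * l"
    have s: "a + 1 < s"
      using elim(2) bc by (simp add: s_def field_simps)
    define G where "G = Gamma (s - a) / ((4 * pi) powr a * Gamma s)"
    have "0 \<le> G"
      using a s by (simp add: G_def)
    have "(SUP u\<in>{0..}. ereal (S_fun l (b * l) (c * l) d u))
            = (SUP u\<in>{0..}. ereal G * ereal (Sigma_fun b c d l u))"
      by (simp add: S_fun_eq_Sigma_fun G_def s_def a_def)
    also have "\<dots> = ereal G * ereal (1 + q l)"
      unfolding elim(1)[symmetric] using \<open>0 \<le> G\<close> by (subst Sup_ereal_mult_left') auto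
    finally have "K_S l (b * l) (c * l) d = ereal (sqrt (G * (1 + q l)))"
      by (simp add: K_S_def ereal_sqrt_def)
    also have "G = (1 + p l) / (4 * pi * s) powr a"
      using a s by (simp add: G_def p_def powr_mult flip: s_def)
    also have "sqrt ((1 + p l) / (4 * pi * s) powr a * (1 + q l))
                 = (1 + r l) / sqrt ((4 * pi * s) powr a)"
      by (simp add: r_def real_sqrt_mult real_sqrt_divide)
    also have "sqrt ((4 * pi * s) powr a) = (4 * pi * s) powr (real d / 4)"
      using a s by (simp add: powr_half_sqrt[symmetric] powr_powr a_def)
    also have "4 * pi * s = 4 * (b + c) * pi * l"
      by (simp add: s_def)
    finally show ?case .
  qed
  with r show ?thesis by blast
qed

end
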